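(* Let $(V,b,m)$ be an infinite, locally finite, connected graph over a non-Archimedean ordered field $\mathbb K$ which is Cauchy complete and has countable cofinality, with $m(x)=b(x)=\sum_{z\in V}b(x,z)$ for all $x\in V$. If $\lim_{n\to\infty}P^n(x,y)=0$ for some $x,y\in V$, then the graph has positive capacity. In this case, for any exhaustion $(K_j)$ of $V$ by finite connected sets and all $\phi\in C_c(V)$, $$\sum_{n=0}^\infty P^n\phi=\lim_{j\to\infty}\Delta_{K_j}^{-1}\phi .$$ In particular, for all $x,y\in V$, $$\sum_{n=0}^\infty P^n(x,y)=G(x,y).$$
   Context: An ordered field $(\mathbb K,\succ)$ is non-Archimedean if there is $\tau\succ0$ with $\tau\prec 1/n$ for all $n\in\mathbb N$. $\mathbb K^+=\{k\in\mathbb K: k\succ0\}$. A sequence $(k_n)$ converges to $k\in\mathbb K$ if for every $c\in\mathbb K^+$ one has $|k_n-k|\preceq c$ for all large $n$. Series and limits of functions are pointwise on $V$. Cauchy complete: every Cauchy sequence converges. Countable cofinality: there is a countable $S\subset\mathbb K$ such that every $k\in\mathbb K$ satisfies $k\preceq s$ for some $s\in S$. A graph $(V,b,m)$ over $\mathbb K$: $V$ is an at most countable set, $m:V\to\mathbb K^+$, and $b:V\times V\to\mathbb K^+\cup\{0\}$ is symmetric with $b(x,x)=0$. Write $x\sim y$ if $b(x,y)\neq0$; locally finite means each vertex has finitely many neighbors; connectedness (of $V$, or of a subset $K$ via paths inside $K$) is with respect to paths $x_0\sim x_1\sim\dots\sim x_n$, and $d$ is the combinatorial graph distance. $B_n(a)=\{x\in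 V: d(a,x)<n\}$. $C_c(V)$ is the set of finitely supported functions $V\to\mathbb K$. Laplacian: $\Delta f(x)=\frac1{m(x)}\sum_{y\in V}(f(x)-f(y))b(x,y)$. With $p(x,y)=b(x,y)/b(x)$, the transition operator is $Pf(x)=\sum_{y\in V}p(x,y)f(y)$, so $\Delta=I-P$; $P^0=I$ and $P^n(x,y)=P^n1_y(x)$, where $1_y$ is $1$ at $y$ and $0$ elsewhere. For finite connected $K$, $\Delta_K$ is the operator on functions $K\to\mathbb K$ obtained by extending by $0$ to $V$, applying $\Delta$, and restricting to $K$; it is invertible, and functions $\Delta_K^{-1}\phi$ (for $\phi$ supported in $K$) are extended by $0$ to $V$. In the limit, $\Delta_{K_j}^{-1}\phi$ is considered for $j$ so large that $K_j$ contains the support of $\phi$. An exhaustion is a sequence of finite sets $K_j\subset V$ with $K_j\subset K_{j+1}$ for all $j$ and $V=\bigcup_jK_j$. For a finite connected $K\subseteq V$ and $a\in K$ there is a unique $v:V\to\mathbb K$ with $\Delta v=0$ on $K\setminus\{a\}$, $v(a)=1$, $v=0$ on $V\setminus K$; put $\mathrm{cap}_K(a)=\Delta v(a)m(a)$ and $\mathrm{cap}_n(a)=\mathrm{cap}_{B_n(a)}(a)$, $n\ge1$. The graph has positive capacity if $\lim_{n\to\infty}\mathrm{cap}_n(a)$ exists in $\mathbb K$ and is nonzero for some (equivalently, all) $a\in V$. For a positive capacity graph the Green function is $G(x,y)=\lim_{j\to\infty}\Delta_{K_j}^{-1}1_y(x)$, which exists in $\mathbb K$ for all $x,y\in V$ and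 does not depend on the exhaustion $(K_j)$ by finite connected sets. *)

theory Defs
  imports Main "HOL-Library.Countable_Set" "HOL-Library.Indicator_Function"
begin

section \<open>Ordered fields\<close>

text \<open>An ordered field is a type of class \<open>linordered_field\<close>. It carries no topology;
  convergence is defined from the order, with tolerances in the field itself.\<close>

definition non_archimedean :: "'k::linordered_field itself \<Rightarrow> bool" where
  "non_archimedean _ \<longleftrightarrow> (\<exists>\<tau>::'k. 0 < \<tau> \<and> (\<forall>n::nat. 1 \<le> n \<longrightarrow> \<tau> < 1 / of_nat n))"

definition converges_to :: "(nat \<Rightarrow> 'k::linordered_field) \<Rightarrow> 'k \<Rightarrow> bool" where
  "converges_to X l \<longleftrightarrow> (\<forall>c>0. \<exists>N. \<forall>n\<ge>N. \<bar>X n - l\<bar> \<le> c)"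

definition cauchy_seq :: "(nat \<Rightarrow> 'k::linordered_field) \<Rightarrow> bool" where
  "cauchy_seq X \<longleftrightarrow> (\<forall>c>0. \<exists>N. \<forall>i\<ge>N. \<forall>j\<ge>N. \<bar>X i - X j\<bar> \<le> c)"

definition cauchy_complete :: "'k::linordered_field itself \<Rightarrow> bool" where
  "cauchy_complete _ \<longleftrightarrow> (\<forall>X::nat \<Rightarrow> 'k. cauchy_seq X \<longrightarrow> (\<exists>l. converges_to X l))"

definition countable_cofinality :: "'k::linordered_field itself \<Rightarrow> bool" where
  "countable_cofinality _ \<longleftrightarrow> (\<exists>S::'k set. countable S \<and> (\<forall>k. \<exists>s\<in>S. k \<le> s))"

definition series_converges_to :: "(nat \<Rightarrow> 'k::linordered_field) \<Rightarrow> 'k \<Rightarrow> bool" where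
  "series_converges_to f s \<longleftrightarrow> converges_to (\<lambda>n. \<Sum>i<n. f i) s"


section \<open>Graphs over an ordered field\<close>

text \<open>The vertex set \<open>V\<close> is the whole type \<open>'v\<close>; subsets of \<open>V\<close> are terms of type \<open>'v set\<close>.\<close>

locale weighted_graph =
  fixes b :: "'v \<Rightarrow> 'v \<Rightarrow> 'k::linordered_field" and m :: "'v \<Rightarrow> 'k"
  assumes countable_vertices: "countable (UNIV :: 'v set)"
    and b_nonneg: "0 \<le> b x y"
    and b_sym: "b x y = b y x"
    and b_diag: "b x x = 0"
    and m_pos: "0 < m x"

definition neighbors :: "('v \<Rightarrow> 'v \<Rightarrow> 'k::zero) \<Rightarrow> 'v \<Rightarrow> 'v set" where
  "neighbors b x = {y. b x y \<noteq> 0}"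

definition locally_finite :: "('v \<Rightarrow> 'v \<Rightarrow> 'k::zero) \<Rightarrow> bool" where
  "locally_finite b \<longleftrightarrow> (\<forall>x. finite (neighbors b x))"

definition edges_in :: "('v \<Rightarrow> 'v \<Rightarrow> 'k::zero) \<Rightarrow> 'v set \<Rightarrow> 'v rel" where
  "edges_in b K = {(x, y). x \<in> K \<and> y \<in> K \<and> b x y \<noteq> 0}"

definition connected_in :: "('v \<Rightarrow> 'v \<Rightarrow> 'k::zero) \<Rightarrow> 'v set \<Rightarrow> bool" where
  "connected_in b K \<longleftrightarrow> (\<forall>x\<in>K. \<forall>y\<in>K. (x, y) \<in> (edges_in b K)\<^sup>*)"

text \<open>The relation power \<open>R ^^ n\<close> relates the endpoints of walks of length \<open>n\<close>. The value of
  \<open>graph_dist\<close> is meaningful only for vertices joined by a path.\<close>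

definition graph_dist :: "('v \<Rightarrow> 'v \<Rightarrow> 'k::zero) \<Rightarrow> 'v \<Rightarrow> 'v \<Rightarrow> nat" where
  "graph_dist b x y = (LEAST n. (x, y) \<in> edges_in b UNIV ^^ n)"

definition graph_ball :: "('v \<Rightarrow> 'v \<Rightarrow> 'k::zero) \<Rightarrow> nat \<Rightarrow> 'v \<Rightarrow> 'v set" where
  "graph_ball b n a = {x. graph_dist b a x < n}"

definition exhaustion :: "(nat \<Rightarrow> 'v set) \<Rightarrow> bool" where
  "exhaustion K \<longleftrightarrow> (\<forall>j. finite (K j)) \<and> (\<forall>j. K j \<subseteq> K (Suc j)) \<and> (\<Union>j. K j) = UNIV"

definition finitely_supported :: "('v \<Rightarrow> 'k::zero) set" where
  "finitely_supported = {\<phi>. finite {x. \<phi> x \<noteq> 0}}"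


section \<open>Laplacian and transition operator\<close>

text \<open>Sums over \<open>V\<close> are taken over the neighbors of \<open>x\<close>, as every other term carries a factor
  \<open>b x y = 0\<close>; on a locally finite graph these index sets are finite.\<close>

definition degree :: "('v \<Rightarrow> 'v \<Rightarrow> 'k::linordered_field) \<Rightarrow> 'v \<Rightarrow> 'k" where
  "degree b x = (\<Sum>y\<in>neighbors b x. b x y)"

definition laplacian ::
  "('v \<Rightarrow> 'v \<Rightarrow> 'k::linordered_field) \<Rightarrow> ('v \<Rightarrow> 'k) \<Rightarrow> ('v \<Rightarrow> 'k) \<Rightarrow> 'v \<Rightarrow> 'k" where
  "laplacian b m f x = 1 / m x * (\<Sum>y\<in>neighbors b x. (f x - f y) * b x y)"

definition trans_prob :: "('v \<Rightarrow> 'v \<Rightarrow> 'k::linordered_field) \<Rightarrow> 'v \<Rightarrow> 'v \<Rightarrow> 'k" where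
  "trans_prob b x y = b x y / degree b x"

definition trans_op ::
  "('v \<Rightarrow> 'v \<Rightarrow> 'k::linordered_field) \<Rightarrow> ('v \<Rightarrow> 'k) \<Rightarrow> 'v \<Rightarrow> 'k" where
  "trans_op b f x = (\<Sum>y\<in>neighbors b x. trans_prob b x y * f y)"

definition trans_kernel ::
  "('v \<Rightarrow> 'v \<Rightarrow> 'k::linordered_field) \<Rightarrow> nat \<Rightarrow> 'v \<Rightarrow> 'v \<Rightarrow> 'k" where
  "trans_kernel b n x y = (trans_op b ^^ n) (indicator {y}) x"


section \<open>Dirichlet Laplacian, capacity and Green function\<close>

text \<open>A function on \<open>K\<close> is represented by its extension by \<open>0\<close> to \<open>V\<close>.\<close>

definition functions_on :: "'v set \<Rightarrow> ('v \<Rightarrow> 'k::zero) set" where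
  "functions_on K = {f. \<forall>x. x \<notin> K \<longrightarrow> f x = 0}"

definition dirichlet_laplacian ::
  "('v \<Rightarrow> 'v \<Rightarrow> 'k::linordered_field) \<Rightarrow> ('v \<Rightarrow> 'k) \<Rightarrow> 'v set \<Rightarrow> ('v \<Rightarrow> 'k) \<Rightarrow> 'v \<Rightarrow> 'k" where
  "dirichlet_laplacian b m K f = (\<lambda>x. if x \<in> K then laplacian b m f x else 0)"

text \<open>The inverse is meaningful for arguments in \<open>functions_on K\<close>.\<close>

definition dirichlet_inverse ::
  "('v \<Rightarrow> 'v \<Rightarrow> 'k::linordered_field) \<Rightarrow> ('v \<Rightarrow> 'k) \<Rightarrow> 'v set \<Rightarrow> ('v \<Rightarrow> 'k) \<Rightarrow> 'v \<Rightarrow> 'k" where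
  "dirichlet_inverse b m K = inv_into (functions_on K) (dirichlet_laplacian b m K)"

definition equilibrium_potential ::
  "('v \<Rightarrow> 'v \<Rightarrow> 'k::linordered_field) \<Rightarrow> ('v \<Rightarrow> 'k) \<Rightarrow> 'v set \<Rightarrow> 'v \<Rightarrow> 'v \<Rightarrow> 'k" where
  "equilibrium_potential b m K a =
    (THE v. (\<forall>x\<in>K - {a}. laplacian b m v x = 0) \<and> v a = 1 \<and> (\<forall>x. x \<notin> K \<longrightarrow> v x = 0))"

definition capacity ::
  "('v \<Rightarrow> 'v \<Rightarrow> 'k::linordered_field) \<Rightarrow> ('v \<Rightarrow> 'k) \<Rightarrow> 'v set \<Rightarrow> 'v \<Rightarrow> 'k" where
  "capacity b m K a = laplacian b m (equilibrium_potential b m K a) a * m a"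

definition positive_capacity ::
  "('v \<Rightarrow> 'v \<Rightarrow> 'k::linordered_field) \<Rightarrow> ('v \<Rightarrow> 'k) \<Rightarrow> bool" where
  "positive_capacity b m \<longleftrightarrow>
    (\<exists>a c. converges_to (\<lambda>n. capacity b m (graph_ball b n a) a) c \<and> c \<noteq> 0)"

text \<open>The Green function is the common limit along all exhaustions by finite connected sets.\<close>

definition green ::
  "('v \<Rightarrow> 'v \<Rightarrow> 'k::linordered_field) \<Rightarrow> ('v \<Rightarrow> 'k) \<Rightarrow> 'v \<Rightarrow> 'v \<Rightarrow> 'k" where
  "green b m x y = (THE g. \<forall>K. exhaustion K \<and> (\<forall>j. connected_in b (K j)) \<longrightarrow>
    converges_to (\<lambda>j. dirichlet_inverse b m (K j) (indicator {y}) x) g)"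

end

theory Submission
  imports Defs
begin

text \<open>Let \<open>Q\<^sub>K\<close> be the transition operator killed outside \<open>K\<close>. Irreducibility spreads
  \<open>P\<^sup>n(x, y) \<rightarrow> 0\<close> to all pairs of vertices, and \<open>\<bar>Q\<^sub>K\<^sup>n \<phi>\<bar> \<le> P\<^sup>n \<bar>\<phi>\<bar>\<close> entails
  \<open>Q\<^sub>K\<^sup>n \<phi> \<rightarrow> 0\<close>, uniformly in \<open>K\<close>. Over a complete non-Archimedean field null sequences are
  summable, so the Neumann series of \<open>Q\<^sub>K\<close> converges. On a finite \<open>K\<close> it inverts \<open>\<Delta>\<^sub>K = I - Q\<^sub>K\<close>,
  whose kernel is trivial because \<open>f = Q\<^sub>K f\<close> gives \<open>f = Q\<^sub>K\<^sup>n f \<rightarrow> 0\<close>. Each single term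
  \<open>Q\<^sub>K\<^sup>n \<phi>(x)\<close> equals \<open>P\<^sup>n \<phi>(x)\<close> once \<open>K\<close> is large, so the uniform tail bound lets \<open>K\<close>
  exhaust \<open>V\<close>. Finally \<open>cap\<^sub>K(a)\<close> is \<open>m(a)\<close> divided by the value at \<open>a\<close> of the Neumann series
  applied to \<open>1\<^sub>a\<close>, and this value is at least 1.\<close>

section \<open>Convergence in ordered fields\<close>

lemma converges_toD:
  assumes "converges_to X l" "0 < c"
  obtains N where "\<And>n. N \<le> n \<Longrightarrow> \<bar>X n - l\<bar> \<le> c"
  using assms unfolding converges_to_def by blast

lemma converges_to_const: "converges_to (\<lambda>n. l) l"
  unfolding converges_to_def by auto

lemma converges_to_cong_eventually:
  assumes "eventually (\<lambda>n. X n = Y n) sequentially" "converges_to X l"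
  shows "converges_to Y l"
  unfolding converges_to_def
proof (intro allI impI)
  fix c :: 'a assume "0 < c"
  then obtain N where N: "\<And>n. N \<le> n \<Longrightarrow> \<bar>X n - l\<bar> \<le> c"
    using assms(2) converges_toD by blast
  obtain M where M: "\<And>n. M \<le> n \<Longrightarrow> X n = Y n"
    using assms(1) unfolding eventually_sequentially by blast
  show "\<exists>N. \<forall>n\<ge>N. \<bar>Y n - l\<bar> \<le> c"
    by (rule exI[of _ "max N M"]) (use N M in \<open>metis max.bounded_iff\<close>)
qed

lemma converges_to_Lipschitz:
  assumes "converges_to X l" "0 \<le> K" "\<And>n. \<bar>Y n - l'\<bar> \<le> K * \<bar>X n - l\<bar>"
  shows "converges_to Y l'"
  unfolding converges_to_def
proof (intro allI impI)
  fix c :: 'a assume c: "0 < c"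
  \<comment> \<open>Dividing the tolerance by \<open>K + 1\<close> instead of \<open>K\<close> keeps
    the quotient positive when \<open>K = 0\<close>.\<close>
  have K1: "0 < K + 1" using assms(2) by simp
  with c obtain N where N: "\<And>n. N \<le> n \<Longrightarrow> \<bar>X n - l\<bar> \<le> c / (K + 1)"
    using assms(1) converges_toD by (metis divide_pos_pos)
  have "\<bar>Y n - l'\<bar> \<le> c" if "N \<le> n" for n
  proof -
    have "\<bar>Y n - l'\<bar> \<le> K * \<bar>X n - l\<bar>" by (rule assms(3))
    also have "\<dots> \<le> (K + 1) * \<bar>X n - l\<bar>" by (simp add: distrib_right)
    also have "\<dots> \<le> (K + 1) * (c / (K + 1))"
      using N[OF that] K1 by (intro mult_left_mono) auto
    also have "\<dots> = c" using K1 by simp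
    finally show ?thesis .
  qed
  then show "\<exists>N. \<forall>n\<ge>N. \<bar>Y n - l'\<bar> \<le> c" by blast
qed

lemma converges_to_cmult:
  assumes "converges_to X l" shows "converges_to (\<lambda>n. k * X n) (k * l)"
  by (rule converges_to_Lipschitz[OF assms, of "\<bar>k\<bar>"])
    (simp_all add: abs_mult flip: right_diff_distrib)

lemma converges_to_add:
  assumes "converges_to X l" "converges_to Y l'"
  shows "converges_to (\<lambda>n. X n + Y n) (l + l')"
  unfolding converges_to_def
proof (intro allI impI)
  fix c :: 'a assume "0 < c"
  then have c: "0 < c / 2" by simp
  obtain N where N: "\<And>n. N \<le> n \<Longrightarrow> \<bar>X n - l\<bar> \<le> c / 2"
    using converges_toD[OF assms(1) c] by blast
  obtain M where M: "\<And>n. M \<le> n \<Longrightarrow> \<bar>Y n - l'\<bar> \<le> c / 2"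
    using converges_toD[OF assms(2) c] by blast
  have "\<bar>X n + Y n - (l + l')\<bar> \<le> c" if "max N M \<le> n" for n
  proof -
    have "\<bar>X n + Y n - (l + l')\<bar> \<le> \<bar>X n - l\<bar> + \<bar>Y n - l'\<bar>"
      using abs_triangle_ineq[of "X n - l" "Y n - l'"] by (simp add: algebra_simps)
    also have "\<dots> \<le> c / 2 + c / 2" using N M that by (intro add_mono) auto
    finally show ?thesis by simp
  qed
  then show "\<exists>N. \<forall>n\<ge>N. \<bar>X n + Y n - (l + l')\<bar> \<le> c" by blast
qed

lemma converges_to_sum:
  assumes "\<And>i. i \<in> I \<Longrightarrow> converges_to (X i) (l i)"
  shows "converges_to (\<lambda>n. \<Sum>i\<in>I. X i n) (\<Sum>i\<in>I. l i)"
  using assms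
  by (induction I rule: infinite_finite_induct)
    (simp_all add: converges_to_const converges_to_add)

lemma converges_to_Suc: "converges_to (\<lambda>n. X (Suc n)) l \<longleftrightarrow> converges_to X l"
proof
  assume L: "converges_to (\<lambda>n. X (Suc n)) l"
  show "converges_to X l"
    unfolding converges_to_def
  proof (intro allI impI)
    fix c :: 'a assume "0 < c"
    then obtain N where N: "\<And>n. N \<le> n \<Longrightarrow> \<bar>X (Suc n) - l\<bar> \<le> c"
      using L converges_toD by blast
    have "\<bar>X n - l\<bar> \<le> c" if "Suc N \<le> n" for n
      using N[of "n - 1"] that by (cases n) auto
    then show "\<exists>N. \<forall>n\<ge>N. \<bar>X n - l\<bar> \<le> c" by blast
  qed
qed (unfold converges_to_def, meson le_Suc_eq)

lemma converges_to_shift: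
  assumes "converges_to X l" shows "converges_to (\<lambda>n. X (n + k)) l"
  using assms unfolding converges_to_def by (meson trans_le_add1)

text \<open>An inequality that holds up to every \<open>e > 0\<close> holds exactly, so passing to
  the limit costs nothing. Uniqueness of limits and the tail bound for series both come from
  this.\<close>

lemma converges_to_dist_le:
  assumes "converges_to X l" "eventually (\<lambda>n. \<bar>X n - a\<bar> \<le> c) sequentially"
  shows "\<bar>l - a\<bar> \<le> c"
proof (rule field_le_epsilon)
  fix e :: 'a assume "0 < e"
  then obtain N where N: "\<And>n. N \<le> n \<Longrightarrow> \<bar>X n - l\<bar> \<le> e"
    using assms(1) converges_toD by blast
  obtain M where M: "\<And>n. M \<le> n \<Longrightarrow> \<bar>X n - a\<bar> \<le> c"
    using assms(2) unfolding eventually_sequentially by blast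
  have "\<bar>X (max N M) - l\<bar> \<le> e" "\<bar>X (max N M) - a\<bar> \<le> c" using N M by auto
  then show "\<bar>l - a\<bar> \<le> c + e" by linarith
qed

lemma converges_to_unique:
  assumes "converges_to X l" "converges_to X l'"
  shows "l = l'"
proof -
  have "\<bar>l - l'\<bar> \<le> 0 + e" if "0 < e" for e
    using assms(2) that unfolding converges_to_def add_0
    by (intro converges_to_dist_le[OF assms(1)]) (simp add: eventually_sequentially)
  then have "\<bar>l - l'\<bar> \<le> 0" by (rule field_le_epsilon)
  then show ?thesis by simp
qed

lemma converges_to_ge:
  assumes "converges_to X l" "eventually (\<lambda>n. a \<le> X n) sequentially"
  shows "a \<le> l"
proof (rule field_le_epsilon)
  fix e :: 'a assume "0 < e"
  then obtain N where N: "\<And>n. N \<le> n \<Longrightarrow> \<bar>X n - l\<bar> \<le> e"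
    using assms(1) converges_toD by blast
  obtain M where M: "\<And>n. M \<le> n \<Longrightarrow> a \<le> X n"
    using assms(2) unfolding eventually_sequentially by blast
  have "\<bar>X (max N M) - l\<bar> \<le> e" "a \<le> X (max N M)" using N M by auto
  then show "a \<le> l + e" by linarith
qed

text \<open>On values at least 1 inversion is Lipschitz with constant 1, because the denominator
  \<open>X n * l\<close> is again at least 1.\<close>

lemma converges_to_inverse:
  assumes "converges_to X l" "\<And>n. 1 \<le> X n"
  shows "converges_to (\<lambda>n. 1 / X n) (1 / l)"
proof (rule converges_to_Lipschitz[OF assms(1), of 1])
  have l: "1 \<le> l" by (rule converges_to_ge[OF assms(1)]) (simp add: assms(2))
  show "\<bar>1 / X n - 1 / l\<bar> \<le> 1 * \<bar>X n - l\<bar>" for n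
  proof -
    have p: "1 \<le> X n * l" using mult_mono[of 1 "X n" 1 l] assms(2)[of n] l by simp
    have "1 / X n - 1 / l = (l - X n) / (X n * l)"
      using assms(2)[of n] l by (simp add: field_simps)
    then have "\<bar>1 / X n - 1 / l\<bar> = \<bar>X n - l\<bar> / (X n * l)"
      using p by (simp add: abs_minus_commute)
    also have "\<dots> \<le> \<bar>X n - l\<bar>"
      using p mult_left_mono[OF p, of "\<bar>X n - l\<bar>"] by (simp add: divide_le_eq)
    finally show ?thesis by simp
  qed
qed simp

section \<open>Series over a non-Archimedean field\<close>

lemma abs_sum_le_infinitesimal:
  fixes f :: "nat \<Rightarrow> 'k::linordered_field"
  assumes "\<forall>n::nat. 1 \<le> n \<longrightarrow> \<tau> < 1 / of_nat n" and "0 < c"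
    and f: "\<And>n. N \<le> n \<Longrightarrow> \<bar>f n\<bar> \<le> c * \<tau>"
  shows "\<bar>\<Sum>n\<in>{N..<M}. f n\<bar> \<le> c"
proof (cases "N < M")
  case True
  have "\<bar>\<Sum>n\<in>{N..<M}. f n\<bar> \<le> (\<Sum>n\<in>{N..<M}. \<bar>f n\<bar>)" by (rule sum_abs)
  also have "\<dots> \<le> (\<Sum>n\<in>{N..<M}. c * \<tau>)" by (rule sum_mono) (simp add: f)
  also have "\<dots> = c * (of_nat (M - N) * \<tau>)" by (simp add: mult_ac)
  \<comment> \<open>However many summands there are, their number is a natural number and
    \<open>\<tau>\<close> lies below its reciprocal. So one infinitesimal factor absorbs the length
    of every finite sum.\<close>
  also have "\<dots> \<le> c * 1"
  proof (rule mult_left_mono)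
    have "1 \<le> M - N" using True by simp
    then have "\<tau> < 1 / of_nat (M - N)" "(0::'k) < of_nat (M - N)"
      using assms(1) by (blast, simp)
    then show "of_nat (M - N) * \<tau> \<le> 1" by (simp add: pos_less_divide_eq mult.commute)
  qed (use assms(2) in simp)
  finally show ?thesis by simp
qed (use assms(2) in simp)

lemma sum_lessThan_diff:
  fixes f :: "nat \<Rightarrow> 'k::linordered_field"
  assumes "N \<le> M"
  shows "(\<Sum>n<M. f n) - (\<Sum>n<N. f n) = (\<Sum>n\<in>{N..<M}. f n)"
proof -
  have "sum f {0..<N} + sum f {N..<M} = sum f {0..<M}"
    using assms by (intro sum.atLeastLessThan_concat) auto
  then show ?thesis by (simp add: atLeast0LessThan algebra_simps)
qed

text \<open>Once the terms stay below \<open>c * \<tau>\<close>, every later block of terms sums to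
  at most \<open>c\<close>, whatever its length. Hence null terms already make the partial sums
  Cauchy.\<close>

lemma nonarch_series_converges:
  fixes f :: "nat \<Rightarrow> 'k::linordered_field"
  assumes "non_archimedean TYPE('k)" "cauchy_complete TYPE('k)" "converges_to f 0"
  shows "\<exists>s. series_converges_to f s"
proof -
  obtain \<tau> :: 'k where \<tau>: "0 < \<tau>" "\<forall>n::nat. 1 \<le> n \<longrightarrow> \<tau> < 1 / of_nat n"
    using assms(1) unfolding non_archimedean_def by blast
  have "cauchy_seq (\<lambda>n. \<Sum>i<n. f i)"
    unfolding cauchy_seq_def
  proof (intro allI impI)
    fix c :: 'k assume c: "0 < c"
    obtain N where N: "\<And>n. N \<le> n \<Longrightarrow> \<bar>f n - 0\<bar> \<le> c * \<tau>"
      using converges_toD[OF assms(3) mult_pos_pos[OF c \<tau>(1)]] by blast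
    have *: "\<bar>(\<Sum>n<j. f n) - (\<Sum>n<i. f n)\<bar> \<le> c" if "N \<le> i" "i \<le> j" for i j
      unfolding sum_lessThan_diff[OF that(2)]
      by (rule abs_sum_le_infinitesimal[OF \<tau>(2) c]) (use N that in auto)
    have "\<bar>(\<Sum>n<i. f n) - (\<Sum>n<j. f n)\<bar> \<le> c" if "N \<le> i" "N \<le> j" for i j
      using *[of i j] *[of j i] that by (cases "i \<le> j") (auto simp: abs_minus_commute)
    then show "\<exists>N. \<forall>i\<ge>N. \<forall>j\<ge>N. \<bar>(\<Sum>n<i. f n) - (\<Sum>n<j. f n)\<bar> \<le> c" by blast
  qed
  then show ?thesis
    using assms(2) unfolding cauchy_complete_def series_converges_to_def by blast
qed

text \<open>The index \<open>N\<close> is governed by the termwise bound alone, so a single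
  \<open>N\<close> controls the tails of a whole family of series with a common bound. This gives
  uniformity in \<open>K\<close> later.\<close>

lemma nonarch_series_tail:
  fixes f :: "nat \<Rightarrow> 'k::linordered_field"
  assumes "\<forall>n::nat. 1 \<le> n \<longrightarrow> \<tau> < 1 / of_nat n" "0 < c"
    and "\<And>n. N \<le> n \<Longrightarrow> \<bar>f n\<bar> \<le> c * \<tau>" and "series_converges_to f s"
  shows "\<bar>s - (\<Sum>n<N. f n)\<bar> \<le> c"
proof (rule converges_to_dist_le[OF assms(4)[unfolded series_converges_to_def]])
  show "\<forall>\<^sub>F M in sequentially. \<bar>(\<Sum>n<M. f n) - (\<Sum>n<N. f n)\<bar> \<le> c"
    using abs_sum_le_infinitesimal[OF assms(1-3)]
    by (auto simp: eventually_sequentially sum_lessThan_diff intro!: exI[of _ N])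
qed

section \<open>Balls\<close>

lemma sym_edges_in:
  assumes "\<And>x y. b x y = b y x" shows "sym (edges_in b K)"
  using assms by (auto simp: sym_def edges_in_def)

text \<open>Connectedness provides some walk from \<open>a\<close> to \<open>x\<close>, so the
  \<open>LEAST\<close> in \<open>graph_dist\<close> is attained and distances can be traded for
  explicit walks.\<close>

lemma graph_ball_iff:
  assumes "connected_in b UNIV"
  shows "x \<in> graph_ball b n a \<longleftrightarrow> (\<exists>k<n. (a, x) \<in> edges_in b UNIV ^^ k)"
proof
  have "\<exists>k. (a, x) \<in> edges_in b UNIV ^^ k"
    using assms by (auto simp: connected_in_def rtrancl_power)
  then have "(a, x) \<in> edges_in b UNIV ^^ graph_dist b a x"
    unfolding graph_dist_def by (rule LeastI_ex)
  then show "x \<in> graph_ball b n a \<Longrightarrow> \<exists>k<n. (a, x) \<in> edges_in b UNIV ^^ k"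
    by (auto simp: graph_ball_def)
next
  show "\<exists>k<n. (a, x) \<in> edges_in b UNIV ^^ k \<Longrightarrow> x \<in> graph_ball b n a"
    by (auto simp: graph_ball_def graph_dist_def intro: le_less_trans[OF Least_le])
qed

lemma finite_walk_endpoints:
  assumes "locally_finite b"
  shows "finite {x. (a, x) \<in> edges_in b UNIV ^^ k}"
proof (induction k)
  case (Suc k)
  have "{x. (a, x) \<in> edges_in b UNIV ^^ Suc k}
      = (\<Union>y\<in>{y. (a, y) \<in> edges_in b UNIV ^^ k}. neighbors b y)"
    by (auto simp: edges_in_def neighbors_def)
  then show ?case using Suc assms by (simp add: locally_finite_def)
qed simp

lemma exhaustion_graph_ball:
  assumes "locally_finite b" "connected_in b UNIV"
  shows "exhaustion (\<lambda>n. graph_ball b n a)"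
  unfolding exhaustion_def
proof (intro conjI allI)
  show "finite (graph_ball b n a)" for n
  proof -
    have "graph_ball b n a = (\<Union>k<n. {x. (a, x) \<in> edges_in b UNIV ^^ k})"
      by (auto simp: graph_ball_iff[OF assms(2)])
    then show ?thesis using finite_walk_endpoints[OF assms(1)] by simp
  qed
  show "graph_ball b n a \<subseteq> graph_ball b (Suc n) a" for n
    by (auto simp: graph_ball_def)
  show "(\<Union>n. graph_ball b n a) = UNIV"
    by (auto simp: graph_ball_def)
qed

lemma exhaustion_eventually:
  assumes "exhaustion K" shows "\<forall>\<^sub>F j in sequentially. x \<in> K j"
proof -
  obtain i where i: "x \<in> K i" using assms unfolding exhaustion_def by blast
  have "x \<in> K j" if "i \<le> j" for j
    using lift_Suc_mono_le[of K, OF _ that] assms i by (auto simp: exhaustion_def)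
  then show ?thesis by (auto simp: eventually_sequentially)
qed

text \<open>Every initial segment of a walk shorter than \<open>n\<close> from \<open>a\<close> is
  also shorter than \<open>n\<close>, so the walk never leaves the ball. Two points are then joined
  through \<open>a\<close> by symmetry.\<close>

lemma connected_graph_ball:
  assumes "\<And>x y. b x y = b y x" "connected_in b UNIV"
  shows "connected_in b (graph_ball b n a)"
proof -
  let ?E = "edges_in b (graph_ball b n a)"
  have E: "(a, x) \<in> ?E\<^sup>*" if "(a, x) \<in> edges_in b UNIV ^^ k" "k < n" for k x
    using that
  proof (induction k arbitrary: x)
    case (Suc k)
    then obtain y where y: "(a, y) \<in> edges_in b UNIV ^^ k" "(y, x) \<in> edges_in b UNIV"
      by auto
    have "x \<in> graph_ball b n a" "y \<in> graph_ball b n a"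
      using Suc.prems y(1) Suc_lessD unfolding graph_ball_iff[OF assms(2)] by blast+
    then have "(y, x) \<in> ?E" using y(2) by (auto simp: edges_in_def)
    then show ?case
      using Suc.IH[OF y(1)] Suc.prems(2) by (meson Suc_lessD rtrancl.rtrancl_into_rtrancl)
  qed simp
  have sym: "sym (?E\<^sup>*)" using sym_edges_in[OF assms(1)] by (rule sym_rtrancl)
  have a: "(a, x) \<in> ?E\<^sup>*" if "x \<in> graph_ball b n a" for x
    using that E unfolding graph_ball_iff[OF assms(2)] by blast
  show ?thesis
    unfolding connected_in_def using rtrancl_trans[OF symD[OF sym a] a] by blast
qed

section \<open>The killed transition operator\<close>

text \<open>Only the output is cut off outside \<open>K\<close>. Choosing \<open>K = UNIV\<close>
  recovers \<open>trans_op b\<close>, so one set of lemmas serves both the killed and the free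
  walk.\<close>

definition killed_op ::
  "('v \<Rightarrow> 'v \<Rightarrow> 'k::linordered_field) \<Rightarrow> 'v set \<Rightarrow> ('v \<Rightarrow> 'k) \<Rightarrow> 'v \<Rightarrow> 'k" where
  "killed_op b K f = (\<lambda>x. if x \<in> K then trans_op b f x else 0)"

lemma killed_op_UNIV [simp]: "killed_op b UNIV = trans_op b"
  by (simp add: killed_op_def fun_eq_iff)

lemma killed_op_sum:
  "killed_op b K (\<lambda>x. \<Sum>i\<in>I. c i * f i x) = (\<lambda>x. \<Sum>i\<in>I. c i * killed_op b K (f i) x)"
proof
  have "trans_op b (\<lambda>x. \<Sum>i\<in>I. c i * f i x) x = (\<Sum>i\<in>I. c i * trans_op b (f i) x)" for x
    unfolding trans_op_def sum_distrib_left by (subst sum.swap) (simp only: mult.left_commute)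
  then show "killed_op b K (\<lambda>x. \<Sum>i\<in>I. c i * f i x) x = (\<Sum>i\<in>I. c i * killed_op b K (f i) x)" for x
    by (simp add: killed_op_def)
qed

lemma killed_pow_sum:
  "(killed_op b K ^^ n) (\<lambda>x. \<Sum>i\<in>I. c i * f i x)
    = (\<lambda>x. \<Sum>i\<in>I. c i * (killed_op b K ^^ n) (f i) x)"
  by (induction n) (simp_all add: killed_op_sum)

lemma killed_pow_cmult:
  "(killed_op b K ^^ n) (\<lambda>x. c * f x) = (\<lambda>x. c * (killed_op b K ^^ n) f x)"
  \<comment> \<open>A scalar multiple is a linear combination over a one-point index set.\<close>
  using killed_pow_sum[of n b K "\<lambda>_. c" "\<lambda>_. f" "{()}"] by simp

text \<open>At a given vertex the operator is a sum over the fixed set of neighbors, so pointwise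
  limits pass through it; an infinite index set gives the constant 0.\<close>

lemma killed_op_converges_to:
  assumes "\<And>x. converges_to (\<lambda>n. F n x) (f x)"
  shows "converges_to (\<lambda>n. killed_op b K (F n) x) (killed_op b K f x)"
  using assms
  by (auto simp: killed_op_def trans_op_def
      intro!: converges_to_const converges_to_sum converges_to_cmult)

lemma eq_sum_indicator:
  fixes \<phi> :: "'v \<Rightarrow> 'k::linordered_field"
  assumes "\<phi> \<in> finitely_supported"
  shows "\<phi> = (\<lambda>x. \<Sum>y\<in>{y. \<phi> y \<noteq> 0}. \<phi> y * indicator {y} x)"
proof
  fix x
  show "\<phi> x = (\<Sum>y\<in>{y. \<phi> y \<noteq> 0}. \<phi> y * indicator {y} x)"
    using assms by (subst sum.cong[OF refl, of _ _ "\<lambda>y. if y = x then \<phi> y else 0"])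
      (auto simp: finitely_supported_def indicator_def)
qed

lemma indicator_finitely_supported:
  "(indicator {y} :: 'v \<Rightarrow> 'k::linordered_field) \<in> finitely_supported"
  by (auto simp: finitely_supported_def indicator_def)

locale random_walk_graph = weighted_graph b m
  for b :: "'v \<Rightarrow> 'v \<Rightarrow> 'k::linordered_field" and m :: "'v \<Rightarrow> 'k" +
  assumes locally_finite: "locally_finite b"
    and m_eq_degree: "m x = degree b x"
begin

lemma finite_neighbors: "finite (neighbors b x)"
  using locally_finite by (simp add: locally_finite_def)

lemma degree_pos: "0 < degree b x"
  using m_pos m_eq_degree by metis

lemma trans_prob_nonneg: "0 \<le> trans_prob b x y"
  using degree_pos[of x] b_nonneg[of x y] by (simp add: trans_prob_def)

text \<open>The normalisation \<open>m = degree b\<close> makes the coefficient of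
  \<open>f x\<close> the total transition probability out of \<open>x\<close>, which is 1.\<close>

lemma laplacian_eq: "laplacian b m f x = f x - trans_op b f x"
proof -
  have "laplacian b m f x = (\<Sum>y\<in>neighbors b x. f x * trans_prob b x y - trans_prob b x y * f y)"
    by (simp add: laplacian_def trans_prob_def m_eq_degree sum_distrib_left algebra_simps diff_divide_distrib)
  also have "\<dots> = f x * (\<Sum>y\<in>neighbors b x. trans_prob b x y) - trans_op b f x"
    by (simp add: trans_op_def sum_subtractf sum_distrib_left)
  also have "(\<Sum>y\<in>neighbors b x. trans_prob b x y) = 1"
    using degree_pos[of x] by (simp add: trans_prob_def degree_def flip: sum_divide_distrib)
  finally show ?thesis by simp
qed

lemma trans_op_mono: "(\<And>y. f y \<le> g y) \<Longrightarrow> trans_op b f x \<le> trans_op b g x"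
  by (simp add: trans_op_def sum_mono mult_left_mono trans_prob_nonneg)

lemma trans_op_nonneg: "(\<And>y. 0 \<le> f y) \<Longrightarrow> 0 \<le> trans_op b f x"
  by (simp add: trans_op_def sum_nonneg trans_prob_nonneg)

lemma killed_op_mono: "(\<And>y. f y \<le> g y) \<Longrightarrow> killed_op b K f x \<le> killed_op b K g x"
  by (simp add: killed_op_def trans_op_mono)

lemma killed_pow_mono:
  "(\<And>y. f y \<le> g y) \<Longrightarrow> (killed_op b K ^^ n) f x \<le> (killed_op b K ^^ n) g x"
  by (induction n arbitrary: x) (simp_all add: killed_op_mono)

lemma killed_pow_nonneg:
  "(\<And>y. 0 \<le> f y) \<Longrightarrow> 0 \<le> (killed_op b K ^^ n) f x"
proof (induction n arbitrary: x)
  case (Suc n)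
  then show ?case by (simp add: killed_op_def trans_op_nonneg)
qed simp

lemma trans_pow_nonneg: "(\<And>y. 0 \<le> f y) \<Longrightarrow> 0 \<le> (trans_op b ^^ n) f x"
  using killed_pow_nonneg[of f n UNIV x] by simp

text \<open>Nonnegative weights let the absolute value move inside the sum, and killing only
  discards mass. The dominating sequence does not depend on \<open>K\<close>.\<close>

lemma abs_killed_pow_le:
  "\<bar>(killed_op b K ^^ n) \<phi> x\<bar> \<le> (trans_op b ^^ n) (\<lambda>y. \<bar>\<phi> y\<bar>) x"
proof (induction n arbitrary: x)
  case (Suc n)
  have "\<bar>trans_op b ((killed_op b K ^^ n) \<phi>) x\<bar>
      \<le> trans_op b (\<lambda>y. \<bar>(killed_op b K ^^ n) \<phi> y\<bar>) x"
    unfolding trans_op_def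
    by (rule order_trans[OF sum_abs]) (simp add: abs_mult trans_prob_nonneg)
  also have "\<dots> \<le> trans_op b ((trans_op b ^^ n) (\<lambda>y. \<bar>\<phi> y\<bar>)) x"
    by (rule trans_op_mono) (rule Suc)
  finally have "\<bar>trans_op b ((killed_op b K ^^ n) \<phi>) x\<bar> \<le> (trans_op b ^^ Suc n) (\<lambda>y. \<bar>\<phi> y\<bar>) x"
    by simp
  moreover have "\<bar>killed_op b K g x\<bar> \<le> \<bar>trans_op b g x\<bar>" for g
    by (simp add: killed_op_def)
  ultimately show ?case unfolding funpow.simps comp_apply by (meson order_trans)
qed simp

section \<open>Irreducibility of the transition kernel\<close>

lemma trans_kernel_nonneg: "0 \<le> trans_kernel b n x y"
  by (simp add: trans_kernel_def trans_pow_nonneg)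

text \<open>This keeps from the Chapman-Kolmogorov sum only the walks that are at \<open>z\<close>
  at time \<open>k\<close>. Formally, monotonicity of \<open>P^k\<close> is applied to a multiple of
  the point mass at \<open>z\<close> lying below \<open>P^n 1_y\<close>.\<close>

lemma trans_kernel_mult_le:
  "trans_kernel b k x z * trans_kernel b n z y \<le> trans_kernel b (k + n) x y"
proof -
  have "trans_kernel b n z y * indicator {z} w \<le> trans_kernel b n w y" for w
    by (auto simp: indicator_def trans_kernel_nonneg)
  then have "(killed_op b UNIV ^^ k) (\<lambda>w. trans_kernel b n z y * indicator {z} w) x
      \<le> (killed_op b UNIV ^^ k) (\<lambda>w. trans_kernel b n w y) x"
    by (rule killed_pow_mono)
  then show ?thesis
    unfolding killed_pow_cmult by (simp add: trans_kernel_def funpow_add mult.commute)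
qed

lemma trans_kernel_one: "b x y \<noteq> 0 \<Longrightarrow> 0 < trans_kernel b 1 x y"
proof -
  assume *: "b x y \<noteq> 0"
  have "trans_kernel b 1 x y = trans_prob b x y"
    using * finite_neighbors[of x]
    by (simp add: trans_kernel_def trans_op_def indicator_def neighbors_def of_bool_def
        if_distrib[of "(*) _"] sum.delta cong: if_cong)
  also have "\<dots> > 0"
    using * b_nonneg[of x y] degree_pos[of x] by (simp add: trans_prob_def)
  finally show ?thesis .
qed

text \<open>Along a path from \<open>x\<close> to \<open>y\<close> the one-step probabilities are
  positive, and their product bounds the kernel from below.\<close>

lemma trans_kernel_pos:
  assumes "connected_in b UNIV" shows "\<exists>k. 0 < trans_kernel b k x y"
proof -
  have "(x, y) \<in> (edges_in b UNIV)\<^sup>*" using assms by (simp add: connected_in_def)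
  then show ?thesis
  proof induction
    case base
    have "0 < trans_kernel b 0 x x" by (simp add: trans_kernel_def)
    then show ?case by blast
  next
    case (step y z)
    then obtain k where "0 < trans_kernel b k x y" by blast
    moreover have "0 < trans_kernel b 1 y z"
      using step(2) by (intro trans_kernel_one) (simp add: edges_in_def)
    ultimately have "0 < trans_kernel b (k + 1) x z"
      using trans_kernel_mult_le[of k x y 1 z] by (meson less_le_trans mult_pos_pos)
    then show ?case by blast
  qed
qed

text \<open>A walk from \<open>x'\<close> to \<open>y'\<close> is extended by a fixed walk from
  \<open>x\<close> to \<open>x'\<close> before it and one from \<open>y'\<close> to \<open>y\<close>
  after it. This bounds \<open>P^n(x', y')\<close> by a constant times
  \<open>P^(n+k+l)(x, y)\<close>.\<close>

lemma trans_kernel_null_everywhere: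
  assumes "connected_in b UNIV" and "converges_to (\<lambda>n. trans_kernel b n x y) 0"
  shows "converges_to (\<lambda>n. trans_kernel b n x' y') 0"
proof -
  obtain k l where k: "0 < trans_kernel b k x x'" and l: "0 < trans_kernel b l y' y"
    using trans_kernel_pos[OF assms(1)] by meson
  define C where "C = trans_kernel b k x x' * trans_kernel b l y' y"
  have C: "0 < C" using k l by (simp add: C_def)
  have "trans_kernel b n x' y' \<le> 1 / C * trans_kernel b (n + (k + l)) x y" for n
  proof -
    have "trans_kernel b k x x' * (trans_kernel b n x' y' * trans_kernel b l y' y)
        \<le> trans_kernel b k x x' * trans_kernel b (n + l) x' y"
      using k by (intro mult_left_mono trans_kernel_mult_le) simp
    also have "\<dots> \<le> trans_kernel b (k + (n + l)) x y" by (rule trans_kernel_mult_le)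
    finally have "trans_kernel b n x' y' * C \<le> trans_kernel b (n + (k + l)) x y"
      by (simp add: C_def mult_ac add_ac)
    then show ?thesis using C by (simp add: pos_le_divide_eq)
  qed
  then show ?thesis
    using C
    by (intro converges_to_Lipschitz[OF converges_to_shift[OF assms(2), of "k + l"], of "1 / C"])
      (simp_all add: trans_kernel_nonneg)
qed

section \<open>Dirichlet Laplacian and comparison along an exhaustion\<close>

lemma dirichlet_laplacian_eq:
  "f \<in> functions_on K \<Longrightarrow> dirichlet_laplacian b m K f = (\<lambda>x. f x - killed_op b K f x)"
  by (auto simp: dirichlet_laplacian_def laplacian_eq killed_op_def functions_on_def)

text \<open>In \<open>n\<close> steps from \<open>x\<close> only finitely many vertices are
  reachable, and all of them eventually lie in \<open>K j\<close>. The induction needs the claim at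
  all neighbors at once, which local finiteness allows.\<close>

lemma killed_pow_eventually_eq:
  assumes "exhaustion K"
  shows "\<forall>\<^sub>F j in sequentially. (killed_op b (K j) ^^ n) \<phi> x = (trans_op b ^^ n) \<phi> x"
proof (induction n arbitrary: x)
  case (Suc n)
  have "\<forall>\<^sub>F j in sequentially. x \<in> K j" using assms by (rule exhaustion_eventually)
  moreover have "\<forall>\<^sub>F j in sequentially. \<forall>y\<in>neighbors b x.
      (killed_op b (K j) ^^ n) \<phi> y = (trans_op b ^^ n) \<phi> y"
    using finite_neighbors Suc by (simp add: eventually_ball_finite)
  ultimately show ?case
  proof eventually_elim
    case (elim j)
    then have "killed_op b (K j) ((killed_op b (K j) ^^ n) \<phi>) x
        = trans_op b ((killed_op b (K j) ^^ n) \<phi>) x"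
      by (simp add: killed_op_def)
    also have "\<dots> = trans_op b ((trans_op b ^^ n) \<phi>) x"
      using elim(2) by (simp add: trans_op_def)
    finally show ?case by simp
  qed
qed simp

lemma functions_on_eventually:
  assumes "exhaustion K" "\<phi> \<in> finitely_supported"
  shows "\<forall>\<^sub>F j in sequentially. \<phi> \<in> functions_on (K j)"
proof -
  have "finite {x. \<phi> x \<noteq> 0}" using assms(2) by (simp add: finitely_supported_def)
  then have "\<forall>\<^sub>F j in sequentially. \<forall>x\<in>{x. \<phi> x \<noteq> 0}. x \<in> K j"
    by (rule eventually_ball_finite) (simp add: exhaustion_eventually[OF assms(1)])
  then show ?thesis by eventually_elim (auto simp: functions_on_def)
qed

end

section \<open>Neumann series\<close>

text \<open>The value is meaningful only where the series converges. For \<open>K = UNIV\<close> it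
  is the sum of \<open>P^n \<phi>\<close> in the theorem.\<close>

definition neumann_sum ::
  "('v \<Rightarrow> 'v \<Rightarrow> 'k::linordered_field) \<Rightarrow> 'v set \<Rightarrow> ('v \<Rightarrow> 'k) \<Rightarrow> 'v \<Rightarrow> 'k" where
  "neumann_sum b K \<phi> x = (THE s. series_converges_to (\<lambda>n. (killed_op b K ^^ n) \<phi> x) s)"

locale null_random_walk = random_walk_graph b m
  for b :: "'v \<Rightarrow> 'v \<Rightarrow> 'k::linordered_field" and m :: "'v \<Rightarrow> 'k" +
  assumes non_arch: "non_archimedean TYPE('k)"
    and complete: "cauchy_complete TYPE('k)"
    and kernel_null: "converges_to (\<lambda>n. trans_kernel b n x y) 0"
begin

lemma trans_pow_null:
  assumes "\<phi> \<in> finitely_supported"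
  shows "converges_to (\<lambda>n. (trans_op b ^^ n) \<phi> x) 0"
proof -
  \<comment> \<open>Expanding \<open>\<phi>\<close> into finitely many point masses reduces the
    claim to the kernel by linearity.\<close>
  have "(trans_op b ^^ n) \<phi> x = (\<Sum>y\<in>{y. \<phi> y \<noteq> 0}. \<phi> y * trans_kernel b n x y)" for n
    using fun_cong[OF killed_pow_sum[of n b UNIV \<phi> "\<lambda>y. indicator {y}" "{y. \<phi> y \<noteq> 0}"], of x]
    unfolding eq_sum_indicator[OF assms, symmetric] by (simp add: trans_kernel_def)
  moreover have "converges_to (\<lambda>n. \<Sum>y\<in>{y. \<phi> y \<noteq> 0}. \<phi> y * trans_kernel b n x y)
      (\<Sum>y\<in>{y. \<phi> y \<noteq> 0}. \<phi> y * 0)"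
    by (intro converges_to_sum converges_to_cmult kernel_null)
  ultimately show ?thesis by simp
qed

lemma trans_pow_abs_null:
  assumes "\<phi> \<in> finitely_supported"
  shows "converges_to (\<lambda>n. (trans_op b ^^ n) (\<lambda>y. \<bar>\<phi> y\<bar>) x) 0"
  using assms by (intro trans_pow_null) (simp add: finitely_supported_def)

lemma killed_pow_null:
  assumes "\<phi> \<in> finitely_supported"
  shows "converges_to (\<lambda>n. (killed_op b K ^^ n) \<phi> x) 0"
  by (rule converges_to_Lipschitz[OF trans_pow_abs_null[OF assms], of 1 _ _ x])
    (auto intro: order_trans[OF abs_killed_pow_le])

lemma neumann_sum_converges:
  assumes "\<phi> \<in> finitely_supported"
  shows "series_converges_to (\<lambda>n. (killed_op b K ^^ n) \<phi> x) (neumann_sum b K \<phi> x)"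
proof -
  obtain s where s: "series_converges_to (\<lambda>n. (killed_op b K ^^ n) \<phi> x) s"
    using nonarch_series_converges[OF non_arch complete killed_pow_null[OF assms]] by blast
  then have "neumann_sum b K \<phi> x = s"
    unfolding neumann_sum_def series_converges_to_def
    by (intro the_equality) (auto intro: converges_to_unique)
  with s show ?thesis by simp
qed

text \<open>Splitting off the term of index 0 relates consecutive partial sums by
  \<open>S_(n+1) = \<phi> + Q S_n\<close>; both sides then pass to the limit.\<close>

lemma neumann_sum_fixpoint:
  assumes "\<phi> \<in> finitely_supported"
  shows "neumann_sum b K \<phi> x = \<phi> x + killed_op b K (neumann_sum b K \<phi>) x"
proof -
  let ?S = "\<lambda>n x. \<Sum>i<n. (killed_op b K ^^ i) \<phi> x"
  have S: "converges_to (\<lambda>n. ?S n x) (neumann_sum b K \<phi> x)" for x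
    using neumann_sum_converges[OF assms] unfolding series_converges_to_def .
  have "?S (Suc n) x = \<phi> x + killed_op b K (?S n) x" for n
    using killed_op_sum[of b K "\<lambda>_. 1" "\<lambda>i. (killed_op b K ^^ i) \<phi>" "{..<n}"]
    by (simp add: sum.lessThan_Suc_shift del: sum.lessThan_Suc)
  moreover have "converges_to (\<lambda>n. \<phi> x + killed_op b K (?S n) x)
      (\<phi> x + killed_op b K (neumann_sum b K \<phi>) x)"
    by (intro converges_to_add converges_to_const killed_op_converges_to S)
  ultimately have "converges_to (\<lambda>n. ?S n x) (\<phi> x + killed_op b K (neumann_sum b K \<phi>) x)"
    using converges_to_Suc[of "\<lambda>n. ?S n x"] by simp
  then show ?thesis using S converges_to_unique by blast
qed

lemma neumann_sum_functions_on:
  assumes "\<phi> \<in> finitely_supported" "\<phi> \<in> functions_on K"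
  shows "neumann_sum b K \<phi> \<in> functions_on K"
  unfolding functions_on_def
proof (intro CollectI allI impI)
  show "neumann_sum b K \<phi> x = 0" if "x \<notin> K" for x
    using that assms(2) by (subst neumann_sum_fixpoint[OF assms(1)])
      (simp add: functions_on_def killed_op_def)
qed

section \<open>Inverting the Dirichlet Laplacian\<close>

lemma dirichlet_laplacian_inj:
  assumes "finite K" shows "inj_on (dirichlet_laplacian b m K) (functions_on K)"
proof (rule inj_onI)
  fix f g assume f: "f \<in> functions_on K" and g: "g \<in> functions_on K"
    and eq: "dirichlet_laplacian b m K f = dirichlet_laplacian b m K g"
  define h where "h = (\<lambda>x. f x - g x)"
  have "{x. h x \<noteq> 0} \<subseteq> K" using f g by (fastforce simp: h_def functions_on_def)
  then have h: "h \<in> finitely_supported"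
    using assms finite_subset by (auto simp: finitely_supported_def)
  have "killed_op b K h x = h x" for x
  proof -
    have "f x - killed_op b K f x = g x - killed_op b K g x"
      using eq unfolding dirichlet_laplacian_eq[OF f] dirichlet_laplacian_eq[OF g]
      by (rule fun_cong)
    moreover have "killed_op b K h x = killed_op b K f x - killed_op b K g x"
      by (simp add: h_def killed_op_def trans_op_def right_diff_distrib sum_subtractf)
    ultimately show ?thesis by (simp add: h_def algebra_simps)
  qed
  then have "killed_op b K h = h" by (rule ext)
  then have "(killed_op b K ^^ n) h = h" for n by (induction n) simp_all
  \<comment> \<open>The sequence \<open>Q^n h\<close> is constantly \<open>h\<close>, yet it is null
    because \<open>h\<close> has finite support; uniqueness of limits gives
    \<open>h = 0\<close>.\<close>
  then have "h x = 0" for x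
    using killed_pow_null[OF h, of K x] converges_to_unique[OF converges_to_const] by auto
  then show "f = g" by (simp add: h_def fun_eq_iff)
qed

lemma dirichlet_inverse_eq:
  assumes "finite K" "\<phi> \<in> functions_on K"
  shows "dirichlet_inverse b m K \<phi> = neumann_sum b K \<phi>"
proof -
  have "{x. \<phi> x \<noteq> 0} \<subseteq> K" using assms(2) by (auto simp: functions_on_def)
  then have \<phi>: "\<phi> \<in> finitely_supported"
    using assms(1) finite_subset by (auto simp: finitely_supported_def)
  note S = neumann_sum_functions_on[OF \<phi> assms(2)]
  have "neumann_sum b K \<phi> x - killed_op b K (neumann_sum b K \<phi>) x = \<phi> x" for x
    using neumann_sum_fixpoint[OF \<phi>, of K x] by (simp add: diff_eq_eq)
  then have "dirichlet_laplacian b m K (neumann_sum b K \<phi>) = \<phi>"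
    unfolding dirichlet_laplacian_eq[OF S] by (rule ext)
  then show ?thesis
    unfolding dirichlet_inverse_def
    using inv_into_f_f[OF dirichlet_laplacian_inj[OF assms(1)] S] by simp
qed

text \<open>The first \<open>N\<close> terms for \<open>K j\<close> eventually coincide exactly with
  those for \<open>UNIV\<close>, so only two tails remain, each at most
  \<open>e / 2\<close>.\<close>

lemma neumann_sum_exhaustion:
  assumes "exhaustion K" "\<phi> \<in> finitely_supported"
  shows "converges_to (\<lambda>j. neumann_sum b (K j) \<phi> x) (neumann_sum b UNIV \<phi> x)"
  unfolding converges_to_def
proof (intro allI impI)
  fix e :: 'k assume "0 < e"
  then have c: "0 < e / 2" by simp
  obtain \<tau> :: 'k where \<tau>: "0 < \<tau>" "\<forall>n::nat. 1 \<le> n \<longrightarrow> \<tau> < 1 / of_nat n"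
    using non_arch unfolding non_archimedean_def by blast
  obtain N where N: "\<And>n. N \<le> n \<Longrightarrow> \<bar>(trans_op b ^^ n) (\<lambda>y. \<bar>\<phi> y\<bar>) x - 0\<bar> \<le> e / 2 * \<tau>"
    using converges_toD[OF trans_pow_abs_null[OF assms(2)] mult_pos_pos[OF c \<tau>(1)]] by blast
  \<comment> \<open>\<open>N\<close> was chosen from the dominating sequence
    \<open>P^n \<bar>\<phi>\<bar>\<close>, hence before \<open>L\<close>; the bound covers every
    \<open>K j\<close> and \<open>UNIV\<close> together.\<close>
  have tail: "\<bar>neumann_sum b L \<phi> x - (\<Sum>n<N. (killed_op b L ^^ n) \<phi> x)\<bar> \<le> e / 2" for L
  proof (rule nonarch_series_tail[OF \<tau>(2) c _ neumann_sum_converges[OF assms(2)]])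
    fix n assume "N \<le> n"
    then show "\<bar>(killed_op b L ^^ n) \<phi> x\<bar> \<le> e / 2 * \<tau>"
      using N[of n] abs_killed_pow_le[of n L \<phi> x] by linarith
  qed
  have "\<forall>\<^sub>F j in sequentially. \<forall>n\<in>{..<N}.
      (killed_op b (K j) ^^ n) \<phi> x = (trans_op b ^^ n) \<phi> x"
    using killed_pow_eventually_eq[OF assms(1)] by (simp add: eventually_ball_finite)
  then have "\<forall>\<^sub>F j in sequentially. \<bar>neumann_sum b (K j) \<phi> x - neumann_sum b UNIV \<phi> x\<bar> \<le> e"
  proof eventually_elim
    case (elim j)
    then have "(\<Sum>n<N. (killed_op b (K j) ^^ n) \<phi> x) = (\<Sum>n<N. (killed_op b UNIV ^^ n) \<phi> x)"
      by simp
    then show ?case using tail[of "K j"] tail[of UNIV] by linarith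
  qed
  then show "\<exists>N. \<forall>j\<ge>N. \<bar>neumann_sum b (K j) \<phi> x - neumann_sum b UNIV \<phi> x\<bar> \<le> e"
    by (simp add: eventually_sequentially)
qed

text \<open>The inverse agrees with the Neumann sum only once \<open>K j\<close> contains the
  support of \<open>\<phi>\<close>, so the limit is transferred by eventual equality.\<close>

lemma dirichlet_inverse_exhaustion:
  assumes "exhaustion K" "\<phi> \<in> finitely_supported"
  shows "converges_to (\<lambda>j. dirichlet_inverse b m (K j) \<phi> x) (neumann_sum b UNIV \<phi> x)"
proof (rule converges_to_cong_eventually[OF _ neumann_sum_exhaustion[OF assms]])
  show "\<forall>\<^sub>F j in sequentially. neumann_sum b (K j) \<phi> x = dirichlet_inverse b m (K j) \<phi> x"
    using functions_on_eventually[OF assms]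
    by eventually_elim (use assms(1) in \<open>simp add: dirichlet_inverse_eq exhaustion_def\<close>)
qed

section \<open>Capacity and Green function\<close>

lemma neumann_sum_indicator_ge_1: "1 \<le> neumann_sum b K (indicator {a}) a"
proof (rule converges_to_ge)
  show "converges_to (\<lambda>n. \<Sum>i<n. (killed_op b K ^^ i) (indicator {a}) a)
      (neumann_sum b K (indicator {a}) a)"
    using neumann_sum_converges[OF indicator_finitely_supported, of K a a]
    by (simp add: series_converges_to_def)
  \<comment> \<open>The term of index 0 equals 1 and the others are nonnegative;
    \<open>1 \<le> n\<close> excludes the empty partial sum.\<close>
  have "1 \<le> (\<Sum>i<n. (killed_op b K ^^ i) (indicator {a}) a)" if "1 \<le> n" for n
  proof -
    have "(\<Sum>i\<in>{0}. (killed_op b K ^^ i) (indicator {a}) a)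
        \<le> (\<Sum>i<n. (killed_op b K ^^ i) (indicator {a}) a)"
      using that by (intro sum_mono2) (auto simp: killed_pow_nonneg simp del: funpow.simps)
    then show ?thesis by simp
  qed
  then show "\<forall>\<^sub>F n in sequentially. 1 \<le> (\<Sum>i<n. (killed_op b K ^^ i) (indicator {a}) a)"
    unfolding eventually_sequentially by blast
qed

text \<open>On \<open>K\<close> the Laplacian of \<open>G\<close> is the point mass at
  \<open>a\<close>, so the equilibrium potential is \<open>G\<close> rescaled to the value 1 at
  \<open>a\<close>, and its Laplacian at \<open>a\<close> is \<open>1 / G a\<close>.\<close>

lemma capacity_eq:
  assumes "finite K" "a \<in> K"
  shows "capacity b m K a = m a / neumann_sum b K (indicator {a}) a"
proof -
  define G where "G = neumann_sum b K (indicator {a})"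
  have ind: "(indicator {a} :: 'v \<Rightarrow> 'k) \<in> functions_on K"
    using assms(2) by (auto simp: functions_on_def indicator_def)
  have G1: "1 \<le> G a" using neumann_sum_indicator_ge_1 by (simp add: G_def)
  have GK: "G \<in> functions_on K"
    unfolding G_def by (rule neumann_sum_functions_on[OF indicator_finitely_supported ind])
  have lap: "laplacian b m (\<lambda>x. t * G x) x = t * indicator {a} x" if "x \<in> K" for t x
  proof -
    have "G x - trans_op b G x = indicator {a} x"
      using neumann_sum_fixpoint[OF indicator_finitely_supported, of K a x] that
      by (simp add: G_def killed_op_def)
    moreover have "trans_op b (\<lambda>x. t * G x) x = t * trans_op b G x"
      by (simp add: trans_op_def sum_distrib_left mult_ac)
    ultimately show ?thesis
      by (simp add: laplacian_eq flip: right_diff_distrib)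
  qed
  have "equilibrium_potential b m K a = (\<lambda>x. 1 / G a * G x)"
    unfolding equilibrium_potential_def
  proof (rule the_equality)
    show "(\<forall>x\<in>K - {a}. laplacian b m (\<lambda>x. 1 / G a * G x) x = 0) \<and>
        1 / G a * G a = 1 \<and> (\<forall>x. x \<notin> K \<longrightarrow> 1 / G a * G x = 0)"
      using GK by (auto simp: lap functions_on_def simp del: times_divide_eq_left)
        (use G1 in simp)
  next
    fix v assume v: "(\<forall>x\<in>K - {a}. laplacian b m v x = 0) \<and> v a = 1 \<and> (\<forall>x. x \<notin> K \<longrightarrow> v x = 0)"
    \<comment> \<open>Any candidate \<open>v\<close> has Dirichlet Laplacian equal to
      \<open>t\<close> times the point mass at \<open>a\<close>, just as \<open>t * G\<close> does.
      Injectivity gives \<open>v = t * G\<close>, and \<open>v a = 1\<close> fixes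
      \<open>t\<close>.\<close>
    define t where "t = laplacian b m v a"
    have "dirichlet_laplacian b m K v x = dirichlet_laplacian b m K (\<lambda>x. t * G x) x" for x
      using v by (cases "x = a") (auto simp: dirichlet_laplacian_def lap t_def)
    then have "dirichlet_laplacian b m K v = dirichlet_laplacian b m K (\<lambda>x. t * G x)"
      by (rule ext)
    then have vt: "v = (\<lambda>x. t * G x)"
      by (rule inj_onD[OF dirichlet_laplacian_inj[OF assms(1)]])
        (use v GK in \<open>auto simp: functions_on_def\<close>)
    with v have "t * G a = 1" by simp
    moreover have "G a \<noteq> 0" using G1 by auto
    ultimately have "t = 1 / G a" by (simp add: eq_divide_eq)
    with vt show "v = (\<lambda>x. 1 / G a * G x)" by simp
  qed
  then show ?thesis
    unfolding capacity_def using lap[OF assms(2), of "1 / G a"] unfolding G_def by simp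
qed

lemma positive_capacity:
  assumes "connected_in b UNIV" shows "positive_capacity b m"
proof -
  \<comment> \<open>An arbitrary vertex serves as the centre. The capacities of its balls tend to
    \<open>m a / green b m a a\<close>, in terms of the Green function identified below.\<close>
  fix a :: 'v
  let ?B = "\<lambda>n. graph_ball b n a" and ?g = "\<lambda>K. neumann_sum b K (indicator {a}) a"
  note ex = exhaustion_graph_ball[OF locally_finite assms, of a]
  have "converges_to (\<lambda>n. 1 / ?g (?B n)) (1 / ?g UNIV)"
    by (intro converges_to_inverse neumann_sum_exhaustion ex indicator_finitely_supported
        neumann_sum_indicator_ge_1)
  then have "converges_to (\<lambda>n. m a * (1 / ?g (?B n))) (m a * (1 / ?g UNIV))"
    by (rule converges_to_cmult)
  moreover have "\<forall>\<^sub>F n in sequentially. m a * (1 / ?g (?B n)) = capacity b m (?B n) a"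
    unfolding eventually_sequentially
  \<comment> \<open>The ball of radius 0 is empty because distances are compared strictly, so
    \<open>a\<close> belongs to the ball only from \<open>n = 1\<close> on.\<close>
  proof (intro exI[of _ 1] allI impI)
    fix n :: nat assume "1 \<le> n"
    then have "a \<in> ?B n" by (auto simp: graph_ball_iff[OF assms] intro!: exI[of _ 0])
    then show "m a * (1 / ?g (?B n)) = capacity b m (?B n) a"
      using ex by (simp add: capacity_eq exhaustion_def)
  qed
  ultimately have "converges_to (\<lambda>n. capacity b m (?B n) a) (m a * (1 / ?g UNIV))"
    by (rule converges_to_cong_eventually[rotated])
  moreover have "m a * (1 / ?g UNIV) \<noteq> 0"
    using m_pos[of a] neumann_sum_indicator_ge_1[of UNIV a] by auto
  ultimately show ?thesis unfolding positive_capacity_def by blast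
qed

lemma green_eq:
  assumes "connected_in b UNIV"
  shows "green b m x y = neumann_sum b UNIV (indicator {y}) x"
  unfolding green_def
proof (rule the_equality)
  show "\<forall>K. exhaustion K \<and> (\<forall>j. connected_in b (K j)) \<longrightarrow>
      converges_to (\<lambda>j. dirichlet_inverse b m (K j) (indicator {y}) x)
        (neumann_sum b UNIV (indicator {y}) x)"
    by (intro allI impI dirichlet_inverse_exhaustion indicator_finitely_supported) (rule conjunct1)
next
  fix g assume g: "\<forall>K. exhaustion K \<and> (\<forall>j. connected_in b (K j)) \<longrightarrow>
      converges_to (\<lambda>j. dirichlet_inverse b m (K j) (indicator {y}) x) g"
  \<comment> \<open>Uniqueness in the \<open>THE\<close> requires at least one exhaustion by finite
    connected sets; the balls around \<open>x\<close> provide it.\<close>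
  note ex = exhaustion_graph_ball[OF locally_finite assms, of x]
  have "converges_to (\<lambda>j. dirichlet_inverse b m (graph_ball b j x) (indicator {y}) x) g"
    using g[rule_format, of "\<lambda>j. graph_ball b j x"] ex connected_graph_ball[OF b_sym assms]
    by simp
  then show "g = neumann_sum b UNIV (indicator {y}) x"
    using dirichlet_inverse_exhaustion[OF ex indicator_finitely_supported]
    by (rule converges_to_unique)
qed

end

theorem theorem8p5:
  fixes b :: "'v \<Rightarrow> 'v \<Rightarrow> 'k::linordered_field" and m :: "'v \<Rightarrow> 'k"
  assumes "non_archimedean TYPE('k)"
    and "cauchy_complete TYPE('k)"
    and "countable_cofinality TYPE('k)"
    and "weighted_graph b m"
    and "infinite (UNIV :: 'v set)"
    and "locally_finite b"
    and "connected_in b (UNIV :: 'v set)"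
    and "\<forall>x. m x = degree b x"
    and "\<exists>x y. converges_to (\<lambda>n. trans_kernel b n x y) 0"
  shows "positive_capacity b m
    \<and> (\<forall>K. exhaustion K \<and> (\<forall>j. connected_in b (K j)) \<longrightarrow>
        (\<forall>\<phi>\<in>finitely_supported. \<exists>u. \<forall>x.
          series_converges_to (\<lambda>n. (trans_op b ^^ n) \<phi> x) (u x)
          \<and> converges_to (\<lambda>j. dirichlet_inverse b m (K j) \<phi> x) (u x)))
    \<and> (\<forall>x y. series_converges_to (\<lambda>n. trans_kernel b n x y) (green b m x y))"
proof -
  interpret random_walk_graph b m
    using assms(4,6,8) by (simp add: random_walk_graph_def random_walk_graph_axioms_def)
  interpret null_random_walk b m
  proof unfold_locales
    \<comment> \<open>The locale asks for a null kernel at all pairs, while the hypothesis gives one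
      pair; irreducibility bridges the gap.\<close>
    show "converges_to (\<lambda>n. trans_kernel b n x y) 0" for x y
      using assms(9) trans_kernel_null_everywhere[OF assms(7)] by blast
  qed (rule assms)+
  show ?thesis
  proof (intro conjI allI impI ballI)
    show "positive_capacity b m" using assms(7) by (rule positive_capacity)
  next
    fix K and \<phi> :: "'v \<Rightarrow> 'k" assume "exhaustion K \<and> (\<forall>j. connected_in b (K j))" "\<phi> \<in> finitely_supported"
    then have "exhaustion K" by blast
    show "\<exists>u. \<forall>x. series_converges_to (\<lambda>n. (trans_op b ^^ n) \<phi> x) (u x)
        \<and> converges_to (\<lambda>j. dirichlet_inverse b m (K j) \<phi> x) (u x)"
    \<comment> \<open>The witness is the Neumann sum of the free walk, which is the same for every
      exhaustion.\<close>
    proof (intro exI[of _ "neumann_sum b UNIV \<phi>"] allI conjI)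
      fix x
      show "series_converges_to (\<lambda>n. (trans_op b ^^ n) \<phi> x) (neumann_sum b UNIV \<phi> x)"
        using neumann_sum_converges[OF \<open>\<phi> \<in> finitely_supported\<close>, of UNIV x] by simp
      show "converges_to (\<lambda>j. dirichlet_inverse b m (K j) \<phi> x) (neumann_sum b UNIV \<phi> x)"
        using \<open>exhaustion K\<close> \<open>\<phi> \<in> finitely_supported\<close> by (rule dirichlet_inverse_exhaustion)
    qed
  next
    show "series_converges_to (\<lambda>n. trans_kernel b n x y) (green b m x y)" for x y
      using neumann_sum_converges[OF indicator_finitely_supported, of UNIV y x]
      by (simp add: green_eq[OF assms(7)] trans_kernel_def)
  qed
qed

end
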